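(* Let $(X,d)$ be a complete metric space and let $T:X\to P_{cl}(X)$ be an operator with $SFix(T)\neq\emptyset$. Suppose there exist $\alpha,\beta,\gamma\ge 0$ with $\alpha<1$ such that $$H(T(x),T(y))\le \alpha\, d(x,y)+\beta\, D(x,T(x))+\gamma\, D(y,T(y))\quad\text{for all } x,y\in X.$$ Then there is a point $x^*\in X$ such that: (i) $Fix(T)=SFix(T)=\{x^*\}$; (ii) for every $\xi\in(0,1)$, $d(x,x^* )\le \dfrac{1+\beta}{(1-\alpha)\,\xi}\,D(x,T(x))$ for all $x\in X$; (iii) if, additionally, $\alpha+2\beta<1$, then for all $x\in X$ the sequence of sets $(T^n(x))_{n\in\mathbb{N}}$ converges to $\{x^*\}$ with respect to the Pompeiu-Hausdorff functional $H$, i.e. $H(T^n(x),\{x^*\})\to 0$ as $n\to\infty$.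
   Context: For a metric space $(X,d)$, $P(X)$ is the family of all nonempty subsets of $X$ and $P_{cl}(X)$ the family of all nonempty closed subsets. For a multivalued operator $T:X\to P(X)$: $Fix(T)=\{x\in X: x\in T(x)\}$ and $SFix(T)=\{x\in X: T(x)=\{x\}\}$. For $A,B\in P(X)$: $D(A,B)=\inf\{d(a,b):a\in A,b\in B\}$, with $D(x,B):=D(\{x\},B)$; $e(A,B)=\sup\{D(a,B):a\in A\}\in[0,+\infty]$; $H(A,B)=\max\{e(A,B),e(B,A)\}\in[0,+\infty]$. For $Y\in P(X)$, $T(Y)=\bigcup_{y\in Y}T(y)$; the iterates are $T^1(x)=T(x)$, $T^{n+1}(x)=T(T^n(x))$. *)

theory Defs
  imports "HOL-Analysis.Analysis"
begin

definition Fix :: "('a \<Rightarrow> 'a set) \<Rightarrow> 'a set" where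
  "Fix T = {x. x \<in> T x}"

definition SFix :: "('a \<Rightarrow> 'a set) \<Rightarrow> 'a set" where
  "SFix T = {x. T x = {x}}"

(* The gap functional D(A,B) = inf {d(a,b) | a in A, b in B} on nonempty sets is the
   library's setdist (whose extra convention, value 0 if A or B is empty, plays no role for
   nonempty-valued operators).  The functionals e and H take values in [0,\<infinity>]. *)

definition excess :: "'a::metric_space set \<Rightarrow> 'a set \<Rightarrow> ennreal" where
  "excess A B = (SUP a\<in>A. ennreal (setdist {a} B))"

definition PH :: "'a::metric_space set \<Rightarrow> 'a set \<Rightarrow> ennreal" where
  "PH A B = max (excess A B) (excess B A)"

(* Iterates T^n(x), extended by T^0(x) = {x}; the lemmas below give the recursion from n = 1. *)

primrec iter :: "('a \<Rightarrow> 'a set) \<Rightarrow> nat \<Rightarrow> 'a \<Rightarrow> 'a set" where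
  "iter T 0 x = {x}"
| "iter T (Suc n) x = (\<Union>y\<in>iter T n x. T y)"

lemma iter_1: "iter T 1 x = T x"
  by simp

lemma iter_add_1: "iter T (n + 1) x = \<Union> (T ` iter T n x)"
  by simp

end

theory Submission
  imports Defs
begin

text \<open>
  Everything is measured from a strict fixed point \<open>z\<close>, which is given. Since \<open>T z = {z}\<close>, the
  contraction condition with \<open>y = z\<close> loses its \<open>\<gamma>\<close> term and compares \<open>T x\<close> with a single point, so
  it says that every \<open>y \<in> T x\<close> satisfies
  \<open>dist y z \<le> \<alpha> * dist x z + \<beta> * setdist {x} (T x)\<close> (\<open>dist_image_strict_fixpoint\<close>). All three claims
  are read off from this one inequality.

  If \<open>x \<in> T x\<close>, then \<open>y = x\<close> gives \<open>dist x z \<le> \<alpha> * dist x z\<close>, hence \<open>x = z\<close>. For the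
  estimate of \<open>dist x z\<close>, the triangle inequality through \<open>y \<in> T x\<close> and the infimum over \<open>y\<close> give
  \<open>(1 - \<alpha>) * dist x z \<le> (1 + \<beta>) * setdist {x} (T x)\<close>; this is the limit case \<open>\<xi> = 1\<close>, and the bound
  only grows as \<open>\<xi>\<close> decreases. Finally,
  \<open>setdist {x} (T x) \<le> dist x y \<le> dist x z + dist y z\<close> turns the inequality into
  \<open>dist y z \<le> k * dist x z\<close> with \<open>k = (\<alpha> + \<beta>) / (1 - \<beta>)\<close>, where \<open>\<alpha> + 2 * \<beta> < 1\<close> ensures
  \<open>\<beta> < 1\<close> and \<open>k < 1\<close>. Thus the iterates of \<open>x\<close> lie in balls around \<open>z\<close> of radius \<open>k ^ n * dist x z\<close>,
  which shrink to \<open>z\<close> (\<open>dist_iter_le_geometric\<close>, \<open>PH_iter_tendsto_0\<close>).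
\<close>

lemma dist_le_PH_singleton:
  assumes "y \<in> A"
  shows "ennreal (dist y z) \<le> PH A {z}"
proof -
  have "ennreal (dist y z) \<le> excess A {z}"
    unfolding excess_def using assms by (intro SUP_upper2[of y]) auto
  then show ?thesis
    unfolding PH_def by (simp add: le_max_iff_disj)
qed

text \<open>
  One excess is a supremum over \<open>A\<close> and needs the hypothesis at every element; the other is the
  distance from \<open>z\<close> to \<open>A\<close>, for which a single element of \<open>A\<close> suffices.
\<close>
lemma PH_singleton_le:
  assumes "A \<noteq> {}" and "\<And>y. y \<in> A \<Longrightarrow> dist y z \<le> r"
  shows "PH A {z} \<le> ennreal r"
proof -
  from assms(1) obtain a where a: "a \<in> A" by blast
  have "setdist {z} A \<le> dist z a"
    using a by (intro setdist_le_dist) auto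
  also have "\<dots> \<le> r"
    using assms(2)[OF a] by (simp add: dist_commute)
  finally have "setdist {z} A \<le> r" .
  then have "excess {z} A \<le> ennreal r"
    unfolding excess_def by (simp add: ennreal_leI)
  moreover have "excess A {z} \<le> ennreal r"
    unfolding excess_def using assms(2) by (intro SUP_least) (auto intro: ennreal_leI)
  ultimately show ?thesis
    unfolding PH_def by simp
qed

lemma iter_nonempty:
  assumes "\<And>x. T x \<noteq> {}"
  shows "iter T n x \<noteq> {}"
  using assms by (induction n) auto

text \<open>
  At a strict fixed point the term \<open>setdist {z} (T z)\<close> vanishes, and the Hausdorff distance to the
  singleton \<open>T z = {z}\<close> dominates the distance to \<open>z\<close> of each single element of \<open>T x\<close>.
\<close>
lemma dist_image_strict_fixpoint:
  fixes T :: "'a::metric_space \<Rightarrow> 'a set" and \<alpha> \<beta> \<gamma> :: real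
  assumes "\<alpha> \<ge> 0" "\<beta> \<ge> 0"
    and contraction: "\<And>x y. PH (T x) (T y)
      \<le> ennreal (\<alpha> * dist x y + \<beta> * setdist {x} (T x) + \<gamma> * setdist {y} (T y))"
    and z: "T z = {z}"
    and y: "y \<in> T x"
  shows "dist y z \<le> \<alpha> * dist x z + \<beta> * setdist {x} (T x)"
proof -
  have "ennreal (dist y z) \<le> PH (T x) {z}"
    using y by (rule dist_le_PH_singleton)
  also have "\<dots> \<le> ennreal (\<alpha> * dist x z + \<beta> * setdist {x} (T x))"
    using contraction[of x z] z by simp
  finally have "ennreal (dist y z) \<le> ennreal (\<alpha> * dist x z + \<beta> * setdist {x} (T x))" .
  moreover have "0 \<le> \<alpha> * dist x z + \<beta> * setdist {x} (T x)"
    using assms(1,2) by (intro add_nonneg_nonneg mult_nonneg_nonneg) auto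
  ultimately show ?thesis
    by (simp only: ennreal_le_iff)
qed

lemma dist_iter_le_geometric:
  fixes T :: "'a::metric_space \<Rightarrow> 'a set"
  assumes "k \<ge> 0" and step: "\<And>x y. y \<in> T x \<Longrightarrow> dist y z \<le> k * dist x z"
    and "y \<in> iter T n x"
  shows "dist y z \<le> k ^ n * dist x z"
  using assms(3)
proof (induction n arbitrary: y)
  case 0
  then show ?case by simp
next
  case (Suc n)
  then obtain w where w: "w \<in> iter T n x" "y \<in> T w" by auto
  have "dist y z \<le> k * dist w z"
    using w(2) by (rule step)
  also have "\<dots> \<le> k * (k ^ n * dist x z)"
    using Suc.IH[OF w(1)] \<open>k \<ge> 0\<close> by (rule mult_left_mono)
  finally show ?case by (simp add: mult.assoc)
qed

lemma PH_iter_tendsto_0: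
  fixes T :: "'a::metric_space \<Rightarrow> 'a set"
  assumes "\<And>x. T x \<noteq> {}" and "0 \<le> k" "k < 1"
    and "\<And>x y. y \<in> T x \<Longrightarrow> dist y z \<le> k * dist x z"
  shows "(\<lambda>n. PH (iter T n x) {z}) \<longlonglongrightarrow> 0"
proof (rule tendsto_sandwich[where f = "\<lambda>_. 0"])
  show "\<forall>\<^sub>F n in sequentially. PH (iter T n x) {z} \<le> ennreal (k ^ n * dist x z)"
    using PH_singleton_le[OF iter_nonempty[OF assms(1)] dist_iter_le_geometric[OF assms(2,4)]]
    by simp
  have "(\<lambda>n. k ^ n * dist x z) \<longlonglongrightarrow> 0"
    using LIMSEQ_realpow_zero[OF assms(2,3)] by (rule tendsto_mult_left_zero)
  then show "(\<lambda>n. ennreal (k ^ n * dist x z)) \<longlonglongrightarrow> 0"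
    using tendsto_ennrealI by fastforce
qed simp_all

theorem theorem3p1:
  fixes T :: "'a::complete_space \<Rightarrow> 'a set" and \<alpha> \<beta> \<gamma> :: real
  assumes T_nonempty: "\<And>x. T x \<noteq> {}"
    and T_closed: "\<And>x. closed (T x)"
    and SFix_nonempty: "SFix T \<noteq> {}"
    and coeffs: "\<alpha> \<ge> 0" "\<beta> \<ge> 0" "\<gamma> \<ge> 0" "\<alpha> < 1"
    and contraction: "\<And>x y. PH (T x) (T y)
      \<le> ennreal (\<alpha> * dist x y + \<beta> * setdist {x} (T x) + \<gamma> * setdist {y} (T y))"
  shows "\<exists>x\<^sub>0.
      (Fix T = SFix T \<and> SFix T = {x\<^sub>0}) \<and>
      (\<forall>\<xi>::real. 0 < \<xi> \<and> \<xi> < 1 \<longrightarrow>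
        (\<forall>x. dist x x\<^sub>0 \<le> (1 + \<beta>) / ((1 - \<alpha>) * \<xi>) * setdist {x} (T x))) \<and>
      (\<alpha> + 2 * \<beta> < 1 \<longrightarrow>
        (\<forall>x. (\<lambda>n. PH (iter T n x) {x\<^sub>0}) \<longlonglongrightarrow> 0))"
proof -
  obtain z where z: "T z = {z}"
    using SFix_nonempty unfolding SFix_def by blast
  have image: "dist y z \<le> \<alpha> * dist x z + \<beta> * setdist {x} (T x)" if "y \<in> T x" for x y
    using dist_image_strict_fixpoint[OF coeffs(1,2) contraction z that] .

  have fixpoint: "x = z" if "x \<in> T x" for x
  proof -
    have "setdist {x} (T x) = 0"
      using that by (intro setdist_eq_0I[of x]) auto
    then have "(1 - \<alpha>) * dist x z \<le> 0"
      using image[OF that] by (simp add: algebra_simps)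
    then have "dist x z \<le> 0"
      using \<open>\<alpha> < 1\<close> by (simp add: mult_le_0_iff)
    then show ?thesis by simp
  qed
  have fix_eq: "Fix T = SFix T \<and> SFix T = {z}"
    unfolding Fix_def SFix_def using fixpoint z by auto

  have estimate: "(1 - \<alpha>) * dist x z \<le> (1 + \<beta>) * setdist {x} (T x)" for x
  proof -
    let ?D = "setdist {x} (T x)"
    \<comment> \<open>The left-hand side below does not mention \<open>y\<close>, so it is bounded by the infimum over \<open>y\<close>.\<close>
    have "dist x z - \<alpha> * dist x z - \<beta> * ?D \<le> dist x y" if "y \<in> T x" for y
      using image[OF that] dist_triangle[of x z y] by linarith
    then have "dist x z - \<alpha> * dist x z - \<beta> * ?D \<le> ?D"
      using T_nonempty by (intro le_setdistI) auto
    then show ?thesis by (simp add: algebra_simps)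
  qed
  have bound: "dist x z \<le> (1 + \<beta>) / ((1 - \<alpha>) * \<xi>) * setdist {x} (T x)"
    if "0 < \<xi>" "\<xi> < 1" for \<xi> x
  proof -
    have "(1 - \<alpha>) * \<xi> * dist x z \<le> (1 - \<alpha>) * dist x z"
      using that \<open>\<alpha> < 1\<close> by (intro mult_right_mono) auto
    then have "(1 - \<alpha>) * \<xi> * dist x z \<le> (1 + \<beta>) * setdist {x} (T x)"
      using estimate[of x] by linarith
    moreover have "(1 - \<alpha>) * \<xi> > 0"
      using that \<open>\<alpha> < 1\<close> by simp
    ultimately show ?thesis
      by (simp add: pos_le_divide_eq mult.commute)
  qed

  have limit: "(\<lambda>n. PH (iter T n x) {z}) \<longlonglongrightarrow> 0" if "\<alpha> + 2 * \<beta> < 1" for x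
  proof (rule PH_iter_tendsto_0[OF T_nonempty])
    have "\<beta> < 1" using that coeffs by linarith
    then show "0 \<le> (\<alpha> + \<beta>) / (1 - \<beta>)" "(\<alpha> + \<beta>) / (1 - \<beta>) < 1"
      using that coeffs by auto
    show "dist y z \<le> (\<alpha> + \<beta>) / (1 - \<beta>) * dist x z" if y: "y \<in> T x" for x y
    proof -
      have "setdist {x} (T x) \<le> dist x y"
        using y by (intro setdist_le_dist) auto
      also have "\<dots> \<le> dist x z + dist y z"
        by (rule dist_triangle2)
      finally have "\<beta> * setdist {x} (T x) \<le> \<beta> * (dist x z + dist y z)"
        using coeffs(2) by (rule mult_left_mono)
      then have "(1 - \<beta>) * dist y z \<le> (\<alpha> + \<beta>) * dist x z"
        using image[OF y] by (simp add: algebra_simps)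
      then show ?thesis
        using \<open>\<beta> < 1\<close> by (simp add: pos_le_divide_eq mult.commute)
    qed
  qed

  show ?thesis
    using fix_eq bound limit by blast
qed

end
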